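(* Let $(\mathcal{M},\boldsymbol{g})$ be a four-dimensional oriented space-time of signature $(+,-,-,-)$, let $\boldsymbol{F}\in\Omega^2(\mathcal{M})$ be a smooth, everywhere regular 2-form, and let $\Omega:\mathcal{M}\to(0,\infty)$ be a smooth function. Then the conformal transformation with factor $\Omega^2$ and the disformal transformation induced by $\boldsymbol{F}$ commute: $\boldsymbol{F}$ is also regular with respect to $\Omega^2\boldsymbol{g}$, and $$\mathcal{D}_{\boldsymbol{F}}(\Omega^2\boldsymbol{g})=\Omega^2\,\mathcal{D}_{\boldsymbol{F}}(\boldsymbol{g}),$$ where $\mathcal{D}_{\boldsymbol{F}}(\boldsymbol{h})=-\kappa_h^{-1}\left(\boldsymbol{F}^{2_h}+\frac{\psi_h}{2}\boldsymbol{h}\right)$ denotes the disformal transform of a Lorentzian metric $\boldsymbol{h}$ induced by $\boldsymbol{F}$.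
   Context: Conventions. For a Lorentzian metric $\boldsymbol{h}$ of signature $(+,-,-,-)$ on the oriented 4-manifold $\mathcal{M}$, with $h=\det(h_{ab})$ in positively oriented coordinates and $[abcd]$ the Levi-Civita permutation symbol with $[0123]=1$, the Hodge dual of a 2-form $\boldsymbol{G}$ is $\star_{h}G_{ab}=\frac12\sqrt{-h}\,[abcd](h^{-1})^{cp}(h^{-1})^{dq}G_{pq}$ (the same orientation is used for all metrics), and the inner product of 2-forms is $\langle\boldsymbol{G},\boldsymbol{H}\rangle_h=\frac12(h^{-1})^{ac}(h^{-1})^{bd}G_{ab}H_{cd}$. Products are $[(\boldsymbol{A}\boldsymbol{B})_h]_{ab}=(h^{-1})^{cd}A_{ac}B_{db}$, so $(\boldsymbol{F}^{2_h})_{ab}=F_{ac}(h^{-1})^{cd}F_{db}$. Invariants of $\boldsymbol{F}$: $\psi_h=\langle\boldsymbol{F},\boldsymbol{F}\rangle_h$, $\phi_h=\langle\boldsymbol{F},\star_h\boldsymbol{F}\rangle_h$, $\kappa_h=\frac12\sqrt{\psi_h^2+\phi_h^2}$. $\boldsymbol{F}$ is regular with respect to $\boldsymbol{h}$ if $\kappa_h\neq0$. A conformal transformation is a map $\boldsymbol{h}\mapsto\Omega^2\boldsymbol{h}$ with $\Omega$ smooth and strictly positive; the disformal transformation induced by $\boldsymbol{F}$ is $\boldsymbol{h}\mapsto\mathcal{D}_{\boldsymbol{F}}(\boldsymbol{h})$. *)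

theory Defs
  imports "HOL-Analysis.Analysis"
begin

section \<open>Smooth oriented 4-manifolds\<close>

text \<open>Only meaningful for open \<open>S\<close>: the derivatives are unrestricted ones, so that the values of
  \<open>f\<close> outside \<open>S\<close> are irrelevant.\<close>

primrec Ck_on :: "nat \<Rightarrow> 'a::real_normed_vector set \<Rightarrow> ('a \<Rightarrow> 'b::real_normed_vector) \<Rightarrow> bool" where
  "Ck_on 0 S f \<longleftrightarrow> continuous_on S f"
| "Ck_on (Suc k) S f \<longleftrightarrow>
     (\<forall>x\<in>S. f differentiable (at x)) \<and> (\<forall>v. Ck_on k S (\<lambda>x. frechet_derivative f (at x) v))"

definition smooth_on :: "'a::real_normed_vector set \<Rightarrow> ('a \<Rightarrow> 'b::real_normed_vector) \<Rightarrow> bool" where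
  "smooth_on S f \<longleftrightarrow> (\<forall>k. Ck_on k S f)"

text \<open>A chart is a pair of a domain and a coordinate map. The index type \<open>4\<close> consists of
  \<open>0, 1, 2, 3\<close>.\<close>

type_synonym 'p chart = "'p set \<times> ('p \<Rightarrow> real^4)"

definition chart_on :: "'p topology \<Rightarrow> 'p chart \<Rightarrow> bool" where
  "chart_on M c \<longleftrightarrow> openin M (fst c) \<and> open (snd c ` fst c) \<and>
     homeomorphic_map (subtopology M (fst c)) (top_of_set (snd c ` fst c)) (snd c)"

definition chart_inv :: "'p chart \<Rightarrow> real^4 \<Rightarrow> 'p" where
  "chart_inv c = inv_into (fst c) (snd c)"

definition transition :: "'p chart \<Rightarrow> 'p chart \<Rightarrow> real^4 \<Rightarrow> real^4" where
  "transition c d = snd d \<circ> chart_inv c"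

text \<open>Row \<open>i\<close>, column \<open>a\<close>: the derivative of the \<open>i\<close>-th coordinate of \<open>d\<close> in the direction of the
  \<open>a\<close>-th coordinate of \<open>c\<close>.\<close>

definition chart_jacobian :: "'p chart \<Rightarrow> 'p chart \<Rightarrow> 'p \<Rightarrow> real^4^4" where
  "chart_jacobian c d p = jacobian (transition c d) (at (snd c p))"

text \<open>An oriented manifold is given by an oriented atlas \<open>A\<close>, not necessarily a maximal one; the
  positively oriented coordinate systems are the members of \<open>A\<close>.\<close>

definition oriented_manifold4 :: "'p topology \<Rightarrow> 'p chart set \<Rightarrow> bool" where
  "oriented_manifold4 M A \<longleftrightarrow>
     Hausdorff_space M \<and> second_countable M \<and>
     (\<forall>c\<in>A. chart_on M c) \<and> (\<Union>c\<in>A. fst c) = topspace M \<and>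
     (\<forall>c\<in>A. \<forall>d\<in>A. smooth_on (snd c ` (fst c \<inter> fst d)) (transition c d)) \<and>
     (\<forall>c\<in>A. \<forall>d\<in>A. \<forall>p\<in>fst c \<inter> fst d. det (chart_jacobian c d p) > 0)"

definition smooth_function :: "'p chart set \<Rightarrow> ('p \<Rightarrow> 'b::real_normed_vector) \<Rightarrow> bool" where
  "smooth_function A f \<longleftrightarrow> (\<forall>c\<in>A. smooth_on (snd c ` fst c) (f \<circ> chart_inv c))"


section \<open>Covariant 2-tensor fields\<close>

text \<open>A covariant 2-tensor field assigns to each chart \<open>c\<close> and point \<open>p\<close> of its domain the matrix
  of components \<open>T c p $ a $ b\<close> in these coordinates, subject to the transformation law.
  Its values for other arguments carry no meaning.\<close>

type_synonym 'p field2 = "'p chart \<Rightarrow> 'p \<Rightarrow> real^4^4"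

definition smooth_tensor2 :: "'p chart set \<Rightarrow> 'p field2 \<Rightarrow> bool" where
  "smooth_tensor2 A T \<longleftrightarrow>
     (\<forall>c\<in>A. smooth_on (snd c ` fst c) (T c \<circ> chart_inv c)) \<and>
     (\<forall>c\<in>A. \<forall>d\<in>A. \<forall>p\<in>fst c \<inter> fst d.
        T c p = transpose (chart_jacobian c d p) ** T d p ** chart_jacobian c d p)"

definition field2_eq :: "'p chart set \<Rightarrow> 'p field2 \<Rightarrow> 'p field2 \<Rightarrow> bool" where
  "field2_eq A S T \<longleftrightarrow> (\<forall>c\<in>A. \<forall>p\<in>fst c. S c p = T c p)"

definition two_form :: "'p chart set \<Rightarrow> 'p field2 \<Rightarrow> bool" where
  "two_form A F \<longleftrightarrow> smooth_tensor2 A F \<and>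
     (\<forall>c\<in>A. \<forall>p\<in>fst c. \<forall>a b. F c p $ a $ b = - (F c p $ b $ a))"

definition minkowski :: "real^4^4" where
  "minkowski = (\<chi> a b. if a = b then (if a = 0 then 1 else -1) else 0)"

text \<open>The columns of \<open>P\<close> form a basis in which the bilinear form \<open>h\<close> is \<open>diag(1,-1,-1,-1)\<close>.\<close>

definition lorentzian_form :: "real^4^4 \<Rightarrow> bool" where
  "lorentzian_form h \<longleftrightarrow> transpose h = h \<and>
     (\<exists>P. invertible P \<and> transpose P ** h ** P = minkowski)"

definition lorentzian_metric :: "'p chart set \<Rightarrow> 'p field2 \<Rightarrow> bool" where
  "lorentzian_metric A h \<longleftrightarrow> smooth_tensor2 A h \<and> (\<forall>c\<in>A. \<forall>p\<in>fst c. lorentzian_form (h c p))"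


section \<open>Algebra of 2-forms in positively oriented coordinates\<close>

definition levi_civita :: "4 \<Rightarrow> 4 \<Rightarrow> 4 \<Rightarrow> 4 \<Rightarrow> real" where
  "levi_civita a b c d =
     (let \<sigma> = (\<lambda>i::4. if i = 0 then a else if i = 1 then b else if i = 2 then c else d)
      in if bij \<sigma> then of_int (sign \<sigma>) else 0)"

definition hodge :: "real^4^4 \<Rightarrow> real^4^4 \<Rightarrow> real^4^4" where
  "hodge h G = (\<chi> a b. 1/2 * sqrt (- det h) *
     (\<Sum>c\<in>UNIV. \<Sum>d\<in>UNIV. \<Sum>p\<in>UNIV. \<Sum>q\<in>UNIV.
        levi_civita a b c d * matrix_inv h $ c $ p * matrix_inv h $ d $ q * G $ p $ q))"

definition form_inner :: "real^4^4 \<Rightarrow> real^4^4 \<Rightarrow> real^4^4 \<Rightarrow> real" where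
  "form_inner h G H = 1/2 *
     (\<Sum>a\<in>UNIV. \<Sum>b\<in>UNIV. \<Sum>c\<in>UNIV. \<Sum>d\<in>UNIV.
        matrix_inv h $ a $ c * matrix_inv h $ b $ d * G $ a $ b * H $ c $ d)"

definition form_prod :: "real^4^4 \<Rightarrow> real^4^4 \<Rightarrow> real^4^4 \<Rightarrow> real^4^4" where
  "form_prod h A B = (\<chi> a b. \<Sum>c\<in>UNIV. \<Sum>d\<in>UNIV. matrix_inv h $ c $ d * A $ a $ c * B $ d $ b)"

definition psi :: "real^4^4 \<Rightarrow> real^4^4 \<Rightarrow> real" where
  "psi h F = form_inner h F F"

definition phi :: "real^4^4 \<Rightarrow> real^4^4 \<Rightarrow> real" where
  "phi h F = form_inner h F (hodge h F)"

definition kappa :: "real^4^4 \<Rightarrow> real^4^4 \<Rightarrow> real" where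
  "kappa h F = 1/2 * sqrt ((psi h F)\<^sup>2 + (phi h F)\<^sup>2)"


section \<open>Regularity, conformal and disformal transformations\<close>

definition regular :: "'p chart set \<Rightarrow> 'p field2 \<Rightarrow> 'p field2 \<Rightarrow> bool" where
  "regular A h F \<longleftrightarrow> (\<forall>c\<in>A. \<forall>p\<in>fst c. kappa (h c p) (F c p) \<noteq> 0)"

definition conformal :: "('p \<Rightarrow> real) \<Rightarrow> 'p field2 \<Rightarrow> 'p field2" where
  "conformal \<Omega> h = (\<lambda>c p. (\<Omega> p)\<^sup>2 *\<^sub>R h c p)"

definition disformal :: "'p field2 \<Rightarrow> 'p field2 \<Rightarrow> 'p field2" where
  "disformal F h = (\<lambda>c p.
     (- inverse (kappa (h c p) (F c p))) *\<^sub>R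
       (form_prod (h c p) (F c p) (F c p) + (psi (h c p) (F c p) / 2) *\<^sub>R h c p))"

end

theory Submission
  imports Defs
begin

text \<open>The identity is pointwise algebra. Scaling \<open>h\<close> to \<open>s h\<close> with \<open>s > 0\<close> scales the inverse by
  \<open>s\<^sup>-\<^sup>1\<close> and \<open>sqrt (- det h)\<close> by \<open>s\<^sup>2\<close>, so in dimension 4 the Hodge dual of a 2-form does not change.
  Hence \<open>\<psi>\<close>, \<open>\<phi>\<close> and \<open>\<kappa>\<close> all have weight \<open>s\<^sup>-\<^sup>2\<close>, while \<open>F\<^sup>2\<close> and \<open>\<psi> h\<close> have weight \<open>s\<^sup>-\<^sup>1\<close>.\<close>

lemma det_scaleR:
  fixes h :: "real^'n^'n"
  shows "det (s *\<^sub>R h) = s ^ CARD('n) * det h"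
  using det_rows_mul[of "\<lambda>_. s" "\<lambda>i. h $ i"]
  by (simp add: scaleR_vec_def vector_scalar_mult_def)

text \<open>\<open>matrix_inv\<close> is a Hilbert choice; associativity leaves it only one
  candidate, since \<open>C = B ** A ** C = B\<close>.\<close>

lemma matrix_inv_unique:
  fixes A :: "'a::semiring_1^'n^'m"
  assumes "A ** B = mat 1" "B ** A = mat 1"
  shows "matrix_inv A = B"
  unfolding matrix_inv_def
proof (rule some_equality)
  fix C assume "A ** C = mat 1 \<and> C ** A = mat 1"
  then have "C = (B ** A) ** C" "B ** (A ** C) = B"
    using assms by simp_all
  then show "C = B"
    by (simp add: matrix_mul_assoc)
qed (use assms in simp)

lemma matrix_inv_scaleR:
  fixes h :: "real^'n^'n"
  assumes "invertible h" "s \<noteq> 0"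
  shows "matrix_inv (s *\<^sub>R h) = inverse s *\<^sub>R matrix_inv h"
proof -
  obtain B where "h ** B = mat 1" "B ** h = mat 1"
    using assms by (auto simp: invertible_def)
  then have "matrix_inv h = B" "matrix_inv (s *\<^sub>R h) = inverse s *\<^sub>R B"
    using assms by (auto intro!: matrix_inv_unique simp: matrix_scalar_ac simp flip: scalar_matrix_assoc)
  then show ?thesis
    by simp
qed

text \<open>Makes \<open>matrix_inv\<close> a genuine inverse of the metric: \<open>det h\<close> is
  a factor of \<open>det minkowski\<close>, a product of diagonal entries 1 and -1.\<close>

lemma invertible_lorentzian:
  assumes "lorentzian_form h"
  shows "invertible h"
proof -
  obtain P where P: "transpose P ** h ** P = minkowski"
    using assms by (auto simp: lorentzian_form_def)
  have "det minkowski = (\<Prod>i\<in>UNIV. minkowski $ i $ i)"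
    by (rule det_diagonal) (simp add: minkowski_def)
  then have "det minkowski \<noteq> 0"
    by (simp add: minkowski_def)
  then have "det h \<noteq> 0"
    unfolding P[symmetric] by (simp add: det_mul)
  then show ?thesis
    by (simp add: invertible_det_nz)
qed

context
  fixes h :: "real^4^4" and s :: real
  assumes inv: "invertible h" and pos: "s > 0"
begin

lemma hodge_scaleR: "hodge (s *\<^sub>R h) G = hodge h G"
proof -
  have "sqrt (- det (s *\<^sub>R h)) = s\<^sup>2 * sqrt (- det h)"
    \<comment> \<open>The factor of the determinant is \<open>s ^ 4\<close>, written as a square so
      that its root is the absolute value of \<open>s\<^sup>2\<close>.\<close>
    using real_sqrt_mult[of "(s\<^sup>2)\<^sup>2" "- det h"]
    by (simp only: real_sqrt_abs) (simp add: det_scaleR)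
  then show ?thesis
    using pos by (simp add: hodge_def matrix_inv_scaleR inv vec_eq_iff sum_distrib_left
        power2_eq_square field_simps)
qed

lemma form_inner_scaleR: "form_inner (s *\<^sub>R h) G H = inverse (s\<^sup>2) * form_inner h G H"
  using pos by (simp add: form_inner_def matrix_inv_scaleR inv sum_distrib_left
      power2_eq_square field_simps)

lemma form_prod_scaleR: "form_prod (s *\<^sub>R h) G H = inverse s *\<^sub>R form_prod h G H"
  using pos by (simp add: form_prod_def matrix_inv_scaleR inv sum_distrib_left vec_eq_iff mult.assoc)

lemma psi_scaleR: "psi (s *\<^sub>R h) G = inverse (s\<^sup>2) * psi h G"
  by (simp add: psi_def form_inner_scaleR)

lemma kappa_scaleR: "kappa (s *\<^sub>R h) G = inverse (s\<^sup>2) * kappa h G"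
proof -
  \<comment> \<open>As the Hodge dual is unchanged, only the inner product contributes to the weight
    of \<open>phi\<close>.\<close>
  have "phi (s *\<^sub>R h) G = inverse (s\<^sup>2) * phi h G"
    by (simp add: phi_def form_inner_scaleR hodge_scaleR)
  then have "(psi (s *\<^sub>R h) G)\<^sup>2 + (phi (s *\<^sub>R h) G)\<^sup>2 =
      (inverse (s\<^sup>2))\<^sup>2 * ((psi h G)\<^sup>2 + (phi h G)\<^sup>2)"
    by (simp add: psi_scaleR power_mult_distrib distrib_left)
  then show ?thesis
    using pos by (simp only: kappa_def real_sqrt_mult real_sqrt_abs) simp
qed

end

theorem proposition3:
  fixes M :: "'p topology"
    and A :: "'p chart set"
    and g F :: "'p field2" and \<Omega> :: "'p \<Rightarrow> real"
  assumes "oriented_manifold4 M A"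
    and "lorentzian_metric A g"
    and "two_form A F"
    and "regular A g F"
    and "smooth_function A \<Omega>"
    and "\<forall>p\<in>topspace M. \<Omega> p > 0"
  shows "regular A (conformal \<Omega> g) F \<and>
         field2_eq A (disformal F (conformal \<Omega> g)) (conformal \<Omega> (disformal F g))"
proof -
  have inv: "invertible (g c p)" if "c \<in> A" "p \<in> fst c" for c p
    using assms(2) that by (simp add: lorentzian_metric_def invertible_lorentzian)
  have pos: "\<Omega> p > 0" if "c \<in> A" "p \<in> fst c" for c p
    \<comment> \<open>Chart domains lie in \<open>topspace M\<close>, their union.\<close>
    using assms(1,6) that by (auto simp: oriented_manifold4_def)
  have "kappa (conformal \<Omega> g c p) (F c p) \<noteq> 0" if "c \<in> A" "p \<in> fst c" for c p
    using assms(4) that inv[OF that] pos[OF that]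
    by (simp add: regular_def conformal_def kappa_scaleR)
  moreover have "disformal F (conformal \<Omega> g) c p = conformal \<Omega> (disformal F g) c p"
    if "c \<in> A" "p \<in> fst c" for c p
  proof -
    define s where "s = (\<Omega> p)\<^sup>2"
    have "s > 0"
      using pos[OF that] by (simp add: s_def)
    \<comment> \<open>The factor \<open>s\<^sup>2\<close> from the inverse of \<open>kappa\<close>
      times \<open>inverse s\<close> from the bracket leaves \<open>s\<close>, the conformal
      factor.\<close>
    then show ?thesis
      using inv[OF that] unfolding disformal_def conformal_def s_def[symmetric]
      by (simp add: kappa_scaleR psi_scaleR form_prod_scaleR scaleR_add_right power2_eq_square
          field_simps)
  qed
  ultimately show ?thesis
    by (simp add: regular_def field2_eq_def)
qed

end
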